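(* Let $k$ be a field, $B$ a finite-dimensional Hopf algebra over $k$, and $(H,\alpha,\phi)$ a braided Hopf algebra in the Yetter–Drinfeld category $({}^B_B\mathcal{YD},C)$, with $B$-action $\alpha$ and $B$-coaction $\phi$. If $\phi$ is trivial (i.e. $\phi(h)=1_B\otimes h$ for all $h\in H$), then $\dim_k\int^l_{H^*}=0$ or $1$.
   Context: ${}^B_B\mathcal{YD}$: left $B$-modules and left $B$-comodules $M$ with $\sum(b\cdot m)_{(-1)}\otimes(b\cdot m)_{(0)}=\sum b_1m_{(-1)}S(b_3)\otimes b_2\cdot m_{(0)}$, with braiding $C(u\otimes v)=\sum u_{(-1)}\cdot v\otimes u_{(0)}$. A braided Hopf algebra is a Hopf algebra object in this category. $\int^l_{H^*}=\{f\in H^*\mid g*f=g(1)f\text{ for all }g\in H^*\}$, where $H^*=\mathrm{Hom}_k(H,k)$ and $(g*f)(x)=\sum g(x_1)f(x_2)$. *)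

theory Defs
  imports Complex_Main "HOL-Library.Poly_Mapping" "HOL-Library.Function_Algebras"
begin

subsection \<open>Tensor products\<close>

text \<open>
  The tensor product of vector spaces is the free vector space on tuples modulo the
  multilinear relations; its elements are cosets. A list of tuples
  \<open>[(v\<^sub>1, w\<^sub>1), \<dots>, (v\<^sub>n, w\<^sub>n)]\<close> stands for the sum
  \<open>v\<^sub>1 \<otimes> w\<^sub>1 + \<dots> + v\<^sub>n \<otimes> w\<^sub>n\<close>, and \<open>tensor2\<close>, \<open>tensor3\<close> map it to the element of the
  tensor product it represents. Every element of a tensor product is such a sum, so a
  (co)multiplication or coaction is given below by a choice of Sweedler representatives
  \<open>\<Delta> x = [(x\<^sub>1, x\<^sub>2), \<dots>]\<close>. All axioms are equations in the tensor product and are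
  multilinear, hence independent of that choice. The iterated tensor product of three spaces
  is identified with the trilinear one.
\<close>

definition free_scale :: "'k::field \<Rightarrow> ('x \<Rightarrow>\<^sub>0 'k) \<Rightarrow> ('x \<Rightarrow>\<^sub>0 'k)"
  where "free_scale c = Poly_Mapping.map (\<lambda>a. c * a)"

lemma lookup_free_scale [simp]:
  "Poly_Mapping.lookup (free_scale c t) x = c * Poly_Mapping.lookup t x"
  by (simp add: free_scale_def Poly_Mapping.map.rep_eq when_def)

interpretation free_space: vector_space free_scale
  by unfold_locales (auto intro!: poly_mapping_eqI simp: lookup_add algebra_simps)

abbreviation basis_vec :: "'x \<Rightarrow> ('x \<Rightarrow>\<^sub>0 'k::field)"
  where "basis_vec p \<equiv> Poly_Mapping.single p 1"

definition formal_sum :: "'x list \<Rightarrow> ('x \<Rightarrow>\<^sub>0 'k::field)"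
  where "formal_sum xs = (\<Sum>p\<leftarrow>xs. basis_vec p)"

definition bilinear_relations ::
  "('k::field \<Rightarrow> 'v::ab_group_add \<Rightarrow> 'v) \<Rightarrow> ('k \<Rightarrow> 'w::ab_group_add \<Rightarrow> 'w)
    \<Rightarrow> ('v \<times> 'w \<Rightarrow>\<^sub>0 'k) set"
  where "bilinear_relations sV sW =
      {basis_vec (v + v', w) - basis_vec (v, w) - basis_vec (v', w) | v v' w. True}
    \<union> {basis_vec (v, w + w') - basis_vec (v, w) - basis_vec (v, w') | v w w'. True}
    \<union> {basis_vec (sV c v, w) - free_scale c (basis_vec (v, w)) | c v w. True}
    \<union> {basis_vec (v, sW c w) - free_scale c (basis_vec (v, w)) | c v w. True}"

definition trilinear_relations ::
  "('k::field \<Rightarrow> 'u::ab_group_add \<Rightarrow> 'u) \<Rightarrow> ('k \<Rightarrow> 'v::ab_group_add \<Rightarrow> 'v)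
    \<Rightarrow> ('k \<Rightarrow> 'w::ab_group_add \<Rightarrow> 'w) \<Rightarrow> ('u \<times> 'v \<times> 'w \<Rightarrow>\<^sub>0 'k) set"
  where "trilinear_relations sU sV sW =
      {basis_vec (u + u', v, w) - basis_vec (u, v, w) - basis_vec (u', v, w) | u u' v w. True}
    \<union> {basis_vec (u, v + v', w) - basis_vec (u, v, w) - basis_vec (u, v', w) | u v v' w. True}
    \<union> {basis_vec (u, v, w + w') - basis_vec (u, v, w) - basis_vec (u, v, w') | u v w w'. True}
    \<union> {basis_vec (sU c u, v, w) - free_scale c (basis_vec (u, v, w)) | c u v w. True}
    \<union> {basis_vec (u, sV c v, w) - free_scale c (basis_vec (u, v, w)) | c u v w. True}
    \<union> {basis_vec (u, v, sW c w) - free_scale c (basis_vec (u, v, w)) | c u v w. True}"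

definition tensor2 ::
  "('k::field \<Rightarrow> 'v::ab_group_add \<Rightarrow> 'v) \<Rightarrow> ('k \<Rightarrow> 'w::ab_group_add \<Rightarrow> 'w)
    \<Rightarrow> ('v \<times> 'w) list \<Rightarrow> ('v \<times> 'w \<Rightarrow>\<^sub>0 'k) set"
  where "tensor2 sV sW xs =
    {t. t - formal_sum xs \<in> free_space.span (bilinear_relations sV sW)}"

definition tensor3 ::
  "('k::field \<Rightarrow> 'u::ab_group_add \<Rightarrow> 'u) \<Rightarrow> ('k \<Rightarrow> 'v::ab_group_add \<Rightarrow> 'v)
    \<Rightarrow> ('k \<Rightarrow> 'w::ab_group_add \<Rightarrow> 'w) \<Rightarrow> ('u \<times> 'v \<times> 'w) list
    \<Rightarrow> ('u \<times> 'v \<times> 'w \<Rightarrow>\<^sub>0 'k) set"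
  where "tensor3 sU sV sW xs =
    {t. t - formal_sum xs \<in> free_space.span (trilinear_relations sU sV sW)}"


subsection \<open>Algebras, coalgebras, Hopf algebras\<close>

text \<open>
  The class \<open>ring_1\<close> excludes the zero ring. This costs nothing for Hopf algebras, ordinary or
  braided, because \<open>\<epsilon> 1 = 1\<close> forces \<open>1 \<noteq> 0\<close>.
\<close>

locale unital_algebra = vector_space scale
  for scale :: "'k::field \<Rightarrow> 'a::ring_1 \<Rightarrow> 'a" (infixr \<open>*s\<close> 75) +
  assumes scale_mult_left: "(c *s x) * y = c *s (x * y)"
    and scale_mult_right: "x * (c *s y) = c *s (x * y)"

locale coalgebra = vector_space scale
  for scale :: "'k::field \<Rightarrow> 'a::ab_group_add \<Rightarrow> 'a" (infixr \<open>*s\<close> 75) +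
  fixes comult :: "'a \<Rightarrow> ('a \<times> 'a) list"
    and counit :: "'a \<Rightarrow> 'k"
  assumes comult_add:
      "tensor2 scale scale (comult (x + y)) = tensor2 scale scale (comult x @ comult y)"
    and comult_scale:
      "tensor2 scale scale (comult (c *s x)) =
       tensor2 scale scale [(c *s x1, x2). (x1, x2) \<leftarrow> comult x]"
    and counit_linear: "Vector_Spaces.linear scale (*) counit"
    and coassoc:
      "tensor3 scale scale scale [(x11, x12, x2). (x1, x2) \<leftarrow> comult x, (x11, x12) \<leftarrow> comult x1] =
       tensor3 scale scale scale [(x1, x21, x22). (x1, x2) \<leftarrow> comult x, (x21, x22) \<leftarrow> comult x2]"
    and counit_left: "(\<Sum>(x1, x2)\<leftarrow>comult x. counit x1 *s x2) = x"
    and counit_right: "(\<Sum>(x1, x2)\<leftarrow>comult x. counit x2 *s x1) = x"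

locale hopf_algebra = unital_algebra scale + coalgebra scale comult counit
  for scale :: "'k::field \<Rightarrow> 'a::ring_1 \<Rightarrow> 'a" (infixr \<open>*s\<close> 75)
    and comult :: "'a \<Rightarrow> ('a \<times> 'a) list"
    and counit :: "'a \<Rightarrow> 'k" +
  fixes antipode :: "'a \<Rightarrow> 'a"
  assumes comult_mult:
      "tensor2 scale scale (comult (x * y)) =
       tensor2 scale scale [(x1 * y1, x2 * y2). (x1, x2) \<leftarrow> comult x, (y1, y2) \<leftarrow> comult y]"
    and comult_one: "tensor2 scale scale (comult 1) = tensor2 scale scale [(1, 1)]"
    and counit_mult: "counit (x * y) = counit x * counit y"
    and counit_one: "counit 1 = 1"
    and antipode_linear: "Vector_Spaces.linear scale scale antipode"
    and antipode_left: "(\<Sum>(x1, x2)\<leftarrow>comult x. antipode x1 * x2) = counit x *s 1"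
    and antipode_right: "(\<Sum>(x1, x2)\<leftarrow>comult x. x1 * antipode x2) = counit x *s 1"


subsection \<open>Yetter-Drinfeld modules\<close>

locale yetter_drinfeld_module =
  B: hopf_algebra scaleB comultB counitB antipodeB + M: vector_space scaleM
  for scaleB :: "'k::field \<Rightarrow> 'b::ring_1 \<Rightarrow> 'b"
    and comultB :: "'b \<Rightarrow> ('b \<times> 'b) list"
    and counitB :: "'b \<Rightarrow> 'k"
    and antipodeB :: "'b \<Rightarrow> 'b"
    and scaleM :: "'k \<Rightarrow> 'm::ab_group_add \<Rightarrow> 'm" +
  fixes act :: "'b \<Rightarrow> 'm \<Rightarrow> 'm"
    and coact :: "'m \<Rightarrow> ('b \<times> 'm) list"
  assumes act_linear_left: "Vector_Spaces.linear scaleB scaleM (\<lambda>b. act b m)"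
    and act_linear_right: "Vector_Spaces.linear scaleM scaleM (act b)"
    and act_mult: "act (b * b') m = act b (act b' m)"
    and act_one: "act 1 m = m"
    and coact_add:
      "tensor2 scaleB scaleM (coact (m + n)) = tensor2 scaleB scaleM (coact m @ coact n)"
    and coact_scale:
      "tensor2 scaleB scaleM (coact (scaleM c m)) =
       tensor2 scaleB scaleM [(b, scaleM c n). (b, n) \<leftarrow> coact m]"
    and coact_coassoc:
      "tensor3 scaleB scaleB scaleM [(b1, b2, n). (b, n) \<leftarrow> coact m, (b1, b2) \<leftarrow> comultB b] =
       tensor3 scaleB scaleB scaleM [(b, b', n'). (b, n) \<leftarrow> coact m, (b', n') \<leftarrow> coact n]"
    and coact_counit: "(\<Sum>(b, n)\<leftarrow>coact m. scaleM (counitB b) n) = m"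
    and yetter_drinfeld:
      "tensor2 scaleB scaleM (coact (act b m)) =
       tensor2 scaleB scaleM
         [(b1 * a * antipodeB b3, act b2 n).
            (b1, b') \<leftarrow> comultB b, (b2, b3) \<leftarrow> comultB b', (a, n) \<leftarrow> coact m]"
begin

text \<open>The braiding \<open>C\<close> on the tensor square of \<open>M\<close>, and the diagonal action and
  codiagonal coaction of \<open>B\<close> on that square.\<close>

definition braiding :: "'m \<Rightarrow> 'm \<Rightarrow> ('m \<times> 'm) list"
  where "braiding u v = [(act b v, u0). (b, u0) \<leftarrow> coact u]"

definition act2 :: "'b \<Rightarrow> ('m \<times> 'm) list \<Rightarrow> ('m \<times> 'm) list"
  where "act2 b t = [(act b1 m, act b2 n). (m, n) \<leftarrow> t, (b1, b2) \<leftarrow> comultB b]"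

definition coact2 :: "('m \<times> 'm) list \<Rightarrow> ('b \<times> 'm \<times> 'm) list"
  where "coact2 t =
    [(a * b, m0, n0). (m, n) \<leftarrow> t, (a, m0) \<leftarrow> coact m, (b, n0) \<leftarrow> coact n]"

end


subsection \<open>Braided Hopf algebras\<close>

text \<open>
  Hopf algebra objects in the category of Yetter-Drinfeld modules: multiplication, unit,
  comultiplication, counit and antipode are required to be \<open>B\<close>-linear and \<open>B\<close>-colinear, and the
  comultiplication is multiplicative for the product
  \<open>(m \<otimes> m) (id \<otimes> C \<otimes> id)\<close> on \<open>H \<otimes> H\<close>. The unit object is \<open>k\<close> with action \<open>counitB\<close> and
  coaction \<open>c \<mapsto> 1 \<otimes> c\<close>.
\<close>

locale braided_hopf_algebra =
  yetter_drinfeld_module scaleB comultB counitB antipodeB scaleH act coact +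
  H: unital_algebra scaleH +
  H: coalgebra scaleH comult counit
  for scaleB :: "'k::field \<Rightarrow> 'b::ring_1 \<Rightarrow> 'b"
    and comultB :: "'b \<Rightarrow> ('b \<times> 'b) list"
    and counitB :: "'b \<Rightarrow> 'k"
    and antipodeB :: "'b \<Rightarrow> 'b"
    and scaleH :: "'k \<Rightarrow> 'h::ring_1 \<Rightarrow> 'h"
    and act :: "'b \<Rightarrow> 'h \<Rightarrow> 'h"
    and coact :: "'h \<Rightarrow> ('b \<times> 'h) list"
    and comult :: "'h \<Rightarrow> ('h \<times> 'h) list"
    and counit :: "'h \<Rightarrow> 'k" +
  fixes antipode :: "'h \<Rightarrow> 'h"
  assumes mult_act: "act b (x * y) = (\<Sum>(u, v)\<leftarrow>act2 b [(x, y)]. u * v)"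
    and mult_coact:
      "tensor2 scaleB scaleH (coact (x * y)) =
       tensor2 scaleB scaleH [(b, u * v). (b, u, v) \<leftarrow> coact2 [(x, y)]]"
    and one_act: "act b 1 = scaleH (counitB b) 1"
    and one_coact: "tensor2 scaleB scaleH (coact 1) = tensor2 scaleB scaleH [(1, 1)]"
    and comult_act:
      "tensor2 scaleH scaleH (comult (act b x)) = tensor2 scaleH scaleH (act2 b (comult x))"
    and comult_coact:
      "tensor3 scaleB scaleH scaleH [(b, y1, y2). (b, y) \<leftarrow> coact x, (y1, y2) \<leftarrow> comult y] =
       tensor3 scaleB scaleH scaleH (coact2 (comult x))"
    and counit_act: "counit (act b x) = counitB b * counit x"
    and counit_coact: "(\<Sum>(b, y)\<leftarrow>coact x. scaleB (counit y) b) = scaleB (counit x) 1"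
    and antipode_linear: "Vector_Spaces.linear scaleH scaleH antipode"
    and antipode_act: "antipode (act b x) = act b (antipode x)"
    and antipode_coact:
      "tensor2 scaleB scaleH (coact (antipode x)) =
       tensor2 scaleB scaleH [(b, antipode y). (b, y) \<leftarrow> coact x]"
    and comult_mult:
      "tensor2 scaleH scaleH (comult (x * y)) =
       tensor2 scaleH scaleH
         [(x1 * v, u * y2).
            (x1, x2) \<leftarrow> comult x, (y1, y2) \<leftarrow> comult y, (v, u) \<leftarrow> braiding x2 y1]"
    and comult_one: "tensor2 scaleH scaleH (comult 1) = tensor2 scaleH scaleH [(1, 1)]"
    and counit_mult: "counit (x * y) = counit x * counit y"
    and counit_one: "counit 1 = 1"
    and antipode_left: "(\<Sum>(x1, x2)\<leftarrow>comult x. antipode x1 * x2) = scaleH (counit x) 1"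
    and antipode_right: "(\<Sum>(x1, x2)\<leftarrow>comult x. x1 * antipode x2) = scaleH (counit x) 1"


subsection \<open>Left integrals in the full linear dual\<close>

definition fun_scale :: "'k::field \<Rightarrow> ('a \<Rightarrow> 'k) \<Rightarrow> ('a \<Rightarrow> 'k)"
  where "fun_scale c f = (\<lambda>x. c * f x)"

interpretation fun_space: vector_space fun_scale
  by unfold_locales (auto simp: fun_scale_def fun_eq_iff algebra_simps)

definition dual :: "('k::field \<Rightarrow> 'h::ab_group_add \<Rightarrow> 'h) \<Rightarrow> ('h \<Rightarrow> 'k) set"
  where "dual scale = {f. Vector_Spaces.linear scale (*) f}"

definition convolution ::
  "('h \<Rightarrow> ('h \<times> 'h) list) \<Rightarrow> ('h \<Rightarrow> 'k) \<Rightarrow> ('h \<Rightarrow> 'k) \<Rightarrow> 'h \<Rightarrow> 'k::field"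
  where "convolution comult g f x = (\<Sum>(x1, x2)\<leftarrow>comult x. g x1 * f x2)"

definition left_integrals ::
  "('k::field \<Rightarrow> 'h::ring_1 \<Rightarrow> 'h) \<Rightarrow> ('h \<Rightarrow> ('h \<times> 'h) list) \<Rightarrow> ('h \<Rightarrow> 'k) set"
  where "left_integrals scale comult =
    {f \<in> dual scale. \<forall>g \<in> dual scale. convolution comult g f = fun_scale (g 1) f}"

end

theory Submission
  imports Defs
begin

text \<open>
  With a trivial coaction the braiding is the flip, so \<open>H\<close> is an ordinary Hopf algebra, possibly
  of infinite dimension. Let \<open>f\<close> be a left integral with \<open>f y \<noteq> 0\<close>. Subtracting a multiple of
  \<open>f\<close> from another left integral gives a left integral \<open>\<phi>\<close> with \<open>\<phi> y = 0\<close>, and it suffices to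
  show \<open>\<phi> = 0\<close>. Every left integral satisfies
  \<open>\<Sum> y\<^sub>1 \<phi>(x y\<^sub>2) = \<Sum> S(x\<^sub>1) \<phi>(x\<^sub>2 y)\<close>, and \<open>f \<circ> S\<close> is a right integral. Hence for
  \<open>v = \<Sum> f(y\<^sub>1) y\<^sub>2\<close> one gets \<open>\<phi>(x v) = \<Sum> f(S(x\<^sub>1)) \<phi>(x\<^sub>2 y) = f(S(x)) \<phi>(y) = 0\<close> for all \<open>x\<close>.
  The first identity for \<open>v\<close> in place of \<open>y\<close> then gives \<open>\<Sum> v\<^sub>1 \<phi>(z v\<^sub>2) = 0\<close> for all \<open>z\<close>,
  so \<open>0 = \<Sum> \<phi>(x S(v\<^sub>1) v\<^sub>2) = \<epsilon>(v) \<phi>(x) = f(y) \<phi>(x)\<close>.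
\<close>

section \<open>Multilinear forms and linear functionals\<close>

text \<open>A Sweedler list determines a tensor only up to the multilinear relations, so every
  identity below is evaluated through scalar-valued forms, which do not see the choice of
  representatives.\<close>

definition bilinear_form ::
  "('k::field \<Rightarrow> 'v::ab_group_add \<Rightarrow> 'v) \<Rightarrow> ('k \<Rightarrow> 'w::ab_group_add \<Rightarrow> 'w)
    \<Rightarrow> ('v \<Rightarrow> 'w \<Rightarrow> 'k) \<Rightarrow> bool"
  where "bilinear_form sV sW \<beta> \<longleftrightarrow> (\<forall>w. (\<lambda>v. \<beta> v w) \<in> dual sV) \<and> (\<forall>v. \<beta> v \<in> dual sW)"

definition trilinear_form ::
  "('k::field \<Rightarrow> 'u::ab_group_add \<Rightarrow> 'u) \<Rightarrow> ('k \<Rightarrow> 'v::ab_group_add \<Rightarrow> 'v)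
    \<Rightarrow> ('k \<Rightarrow> 'w::ab_group_add \<Rightarrow> 'w) \<Rightarrow> ('u \<Rightarrow> 'v \<Rightarrow> 'w \<Rightarrow> 'k) \<Rightarrow> bool"
  where "trilinear_form sU sV sW \<tau> \<longleftrightarrow>
    (\<forall>v w. (\<lambda>u. \<tau> u v w) \<in> dual sU) \<and> (\<forall>u. bilinear_form sV sW (\<tau> u))"

lemma vector_space_field: "vector_space ((*) :: 'k::field \<Rightarrow> 'k \<Rightarrow> 'k)"
  by unfold_locales (simp_all add: algebra_simps)

lemma dual_iff:
  assumes "vector_space scale"
  shows "f \<in> dual scale \<longleftrightarrow>
    (\<forall>x y. f (x + y) = f x + f y) \<and> (\<forall>c x. f (scale c x) = c * f x)"
  using assms vector_space_field by (auto simp: dual_def Vector_Spaces.linear_iff)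

lemma dual_add: "f \<in> dual scale \<Longrightarrow> f (x + y) = f x + f y"
  and dual_scale: "f \<in> dual scale \<Longrightarrow> f (scale c x) = c * f x"
  by (auto simp: dual_def Vector_Spaces.linear_iff)

lemma dual_zero: "f \<in> dual scale \<Longrightarrow> f 0 = 0"
  using dual_add[of f scale 0 0] by (metis add.right_neutral add_left_cancel)

lemma dual_sum_list: "f \<in> dual scale \<Longrightarrow> f (\<Sum>p\<leftarrow>t. h p) = (\<Sum>p\<leftarrow>t. f (h p))"
  by (induction t) (simp_all add: dual_add dual_zero)

lemma sum_list_map_concat:
  "sum_list (map f (concat xss)) = (\<Sum>xs\<leftarrow>xss. sum_list (map f xs))"
  by (induction xss) simp_all

lemma sum_list_map_concat_map:
  "sum_list (map f (concat (map g xs))) = (\<Sum>x\<leftarrow>xs. sum_list (map f (g x)))"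
  by (simp add: sum_list_map_concat comp_def)

lemma sum_list_map_swap:
  fixes h :: "'x \<Rightarrow> 'y \<Rightarrow> 'z::comm_monoid_add"
  shows "(\<Sum>x\<leftarrow>xs. \<Sum>y\<leftarrow>ys. h x y) = (\<Sum>y\<leftarrow>ys. \<Sum>x\<leftarrow>xs. h x y)"
  by (induction xs) (simp_all add: sum_list_addf)

section \<open>Equality in tensor products tested by multilinear forms\<close>

lemma coset_eq_iff:
  "{t. t - a \<in> free_space.span R} = {t. t - b \<in> free_space.span R} \<longleftrightarrow>
    a - b \<in> free_space.span R"
proof
  assume "{t. t - a \<in> free_space.span R} = {t. t - b \<in> free_space.span R}"
  moreover have "a \<in> {t. t - a \<in> free_space.span R}"
    by (simp add: free_space.span_zero)
  ultimately show "a - b \<in> free_space.span R" by auto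
next
  assume ab: "a - b \<in> free_space.span R"
  have "t - a \<in> free_space.span R \<longleftrightarrow> t - b \<in> free_space.span R" for t
    using free_space.span_add_eq2[OF ab, of "t - a"] by simp
  then show "{t. t - a \<in> free_space.span R} = {t. t - b \<in> free_space.span R}" by simp
qed

definition linear_extension :: "('x \<Rightarrow> 'k::field) \<Rightarrow> ('x \<Rightarrow>\<^sub>0 'k) \<Rightarrow> 'k"
  where "linear_extension \<beta> t = (\<Sum>p\<in>Poly_Mapping.keys t. Poly_Mapping.lookup t p * \<beta> p)"

text \<open>Cancellation and multiplication by 0 can shrink supports; summing over a common finite
  superset makes additivity and homogeneity termwise.\<close>

lemma linear_extension_superset:
  assumes "finite F" "Poly_Mapping.keys t \<subseteq> F"
  shows "linear_extension \<beta> t = (\<Sum>p\<in>F. Poly_Mapping.lookup t p * \<beta> p)"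
  unfolding linear_extension_def using assms
  by (intro sum.mono_neutral_left) (auto simp: in_keys_iff)

lemma linear_extension_add:
  "linear_extension \<beta> (s + t) = linear_extension \<beta> s + linear_extension \<beta> t"
proof -
  let ?F = "Poly_Mapping.keys s \<union> Poly_Mapping.keys t"
  have "linear_extension \<beta> (s + t) = (\<Sum>p\<in>?F. Poly_Mapping.lookup (s + t) p * \<beta> p)"
    using Poly_Mapping.keys_add[of s t] by (intro linear_extension_superset) auto
  also have "\<dots> = (\<Sum>p\<in>?F. Poly_Mapping.lookup s p * \<beta> p) + (\<Sum>p\<in>?F. Poly_Mapping.lookup t p * \<beta> p)"
    by (simp add: lookup_add distrib_right sum.distrib)
  also have "\<dots> = linear_extension \<beta> s + linear_extension \<beta> t"
    by (subst (1 2) linear_extension_superset[of ?F]) auto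
  finally show ?thesis .
qed

lemma linear_extension_scale: "linear_extension \<beta> (free_scale c t) = c * linear_extension \<beta> t"
proof -
  have "Poly_Mapping.keys (free_scale c t) \<subseteq> Poly_Mapping.keys t"
    by (auto simp: in_keys_iff)
  then have "linear_extension \<beta> (free_scale c t) =
      (\<Sum>p\<in>Poly_Mapping.keys t. Poly_Mapping.lookup (free_scale c t) p * \<beta> p)"
    by (intro linear_extension_superset) auto
  then show ?thesis
    by (simp add: linear_extension_def sum_distrib_left mult.assoc)
qed

lemma linear_extension_linear: "Vector_Spaces.linear free_scale (*) (linear_extension \<beta>)"
  using free_space.vector_space_axioms vector_space_field
  by (simp add: Vector_Spaces.linear_iff linear_extension_add linear_extension_scale)

lemma linear_extension_basis_vec [simp]: "linear_extension \<beta> (basis_vec p) = \<beta> p"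
  by (simp add: linear_extension_def)

lemma linear_formal_sum:
  assumes "Vector_Spaces.linear free_scale (*) l"
  shows "l (formal_sum xs) = (\<Sum>p\<leftarrow>xs. l (basis_vec p))"
  using assms dual_sum_list[of l free_scale] by (simp add: dual_def formal_sum_def)

lemma linear_vanishes_on_span:
  assumes "Vector_Spaces.linear free_scale (*) l" "\<And>r. r \<in> R \<Longrightarrow> l r = (0::'k::field)"
    and "t \<in> free_space.span R"
  shows "l t = 0"
  using assms(3)
proof (induction rule: free_space.span_induct_alt)
  case base
  show ?case using assms(1) dual_zero[of l free_scale] by (simp add: dual_def)
next
  case (step c x y)
  then show ?case using assms(1,2) by (simp add: Vector_Spaces.linear_iff)
qed

text \<open>Universal property of the tensor product: the linear extension of \<beta> to the free
  space kills each bilinear relation, hence factors through the quotient.\<close>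

lemma tensor2_eqD:
  assumes "tensor2 sV sW xs = tensor2 sV sW ys" "bilinear_form sV sW \<beta>"
  shows "(\<Sum>(v, w)\<leftarrow>xs. \<beta> v w) = (\<Sum>(v, w)\<leftarrow>ys. \<beta> v w)"
proof -
  let ?l = "linear_extension (\<lambda>(v, w). \<beta> v w)"
  interpret l: Vector_Spaces.linear free_scale "(*)" ?l by (rule linear_extension_linear)
  have dl: "\<And>v. \<beta> v \<in> dual sW" and dr: "\<And>w. (\<lambda>v. \<beta> v w) \<in> dual sV"
    using assms(2) by (auto simp: bilinear_form_def)
  have "formal_sum xs - formal_sum ys \<in> free_space.span (bilinear_relations sV sW)"
    using assms(1) by (simp add: tensor2_def coset_eq_iff)
  moreover have "?l r = 0" if "r \<in> bilinear_relations sV sW" for r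
    using that unfolding bilinear_relations_def
    by (elim UnE CollectE exE conjE) (simp_all add: l.diff linear_extension_scale
        dual_add[OF dl] dual_scale[OF dl] dual_add[OF dr] dual_scale[OF dr])
  ultimately have "?l (formal_sum xs - formal_sum ys) = 0"
    using linear_vanishes_on_span[OF linear_extension_linear] by blast
  then show ?thesis
    by (simp add: l.diff linear_formal_sum[OF linear_extension_linear])
qed

lemma tensor3_eqD:
  assumes "tensor3 sU sV sW xs = tensor3 sU sV sW ys" "trilinear_form sU sV sW \<tau>"
  shows "(\<Sum>(u, v, w)\<leftarrow>xs. \<tau> u v w) = (\<Sum>(u, v, w)\<leftarrow>ys. \<tau> u v w)"
proof -
  let ?l = "linear_extension (\<lambda>(u, v, w). \<tau> u v w)"
  interpret l: Vector_Spaces.linear free_scale "(*)" ?l by (rule linear_extension_linear)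
  have d1: "\<And>v w. (\<lambda>u. \<tau> u v w) \<in> dual sU" and d2: "\<And>u w. (\<lambda>v. \<tau> u v w) \<in> dual sV"
    and d3: "\<And>u v. \<tau> u v \<in> dual sW"
    using assms(2) by (auto simp: trilinear_form_def bilinear_form_def)
  have "formal_sum xs - formal_sum ys \<in> free_space.span (trilinear_relations sU sV sW)"
    using assms(1) by (simp add: tensor3_def coset_eq_iff)
  moreover have "?l r = 0" if "r \<in> trilinear_relations sU sV sW" for r
    using that unfolding trilinear_relations_def
    by (elim UnE CollectE exE conjE) (simp_all add: l.diff linear_extension_scale
        dual_add[OF d1] dual_scale[OF d1] dual_add[OF d2] dual_scale[OF d2]
        dual_add[OF d3] dual_scale[OF d3])
  ultimately have "?l (formal_sum xs - formal_sum ys) = 0"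
    using linear_vanishes_on_span[OF linear_extension_linear] by blast
  then show ?thesis
    by (simp add: l.diff linear_formal_sum[OF linear_extension_linear])
qed

text \<open>A maximal independent subset \<open>A\<close> of \<open>R\<close> has the same span as
  \<open>R\<close>, and \<open>insert t A\<close> is still independent. A functional may therefore
  be prescribed as 1 at \<open>t\<close> and 0 on \<open>A\<close>.\<close>

lemma linear_separates_from_span:
  fixes t :: "'x \<Rightarrow>\<^sub>0 'k::field"
  assumes "t \<notin> free_space.span R"
  shows "\<exists>l :: ('x \<Rightarrow>\<^sub>0 'k) \<Rightarrow> 'k. Vector_Spaces.linear free_scale (*) l \<and> (\<forall>r\<in>R. l r = 0) \<and> l t = 1"
proof -
  interpret P: vector_space_pair free_scale "(*) :: 'k \<Rightarrow> 'k \<Rightarrow> 'k"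
    using free_space.vector_space_axioms vector_space_field
    by (rule vector_space_pair.intro)
  obtain A where A: "A \<subseteq> R" "free_space.independent A" "R \<subseteq> free_space.span A"
    using free_space.maximal_independent_subset by blast
  have "t \<notin> free_space.span A"
    using assms A(1) free_space.span_mono by blast
  moreover from this have tA: "t \<notin> A"
    using free_space.span_base by blast
  ultimately have "free_space.independent (insert t A)"
    using A(2) by (simp add: free_space.independent_insertI)
  then obtain l where l: "Vector_Spaces.linear free_scale (*) l"
      "\<forall>x\<in>insert t A. l x = (if x = t then 1 else 0)"
    using P.linear_independent_extend[of _ "\<lambda>x. if x = t then 1 else 0"] by blast
  have "l r = 0" if "r \<in> R" for r
    by (rule linear_vanishes_on_span[OF l(1), of A]) (use l(2) A(3) tA that in auto)
  with l show ?thesis by auto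
qed

text \<open>Converse of \<open>tensor2_eqD\<close>: bilinear forms separate tensors. If the two
  cosets differed, some functional would kill the relations but not the difference; its values on
  basis vectors form a bilinear form that tells the two lists apart.\<close>

lemma tensor2_eqI:
  assumes V: "vector_space sV" and W: "vector_space sW"
    and eq: "\<And>\<beta>. bilinear_form sV sW \<beta> \<Longrightarrow> (\<Sum>(v, w)\<leftarrow>xs. \<beta> v w) = (\<Sum>(v, w)\<leftarrow>ys. \<beta> v w)"
  shows "tensor2 sV sW xs = tensor2 sV sW ys"
proof (rule ccontr)
  assume "tensor2 sV sW xs \<noteq> tensor2 sV sW ys"
  then have "formal_sum xs - formal_sum ys \<notin> free_space.span (bilinear_relations sV sW)"
    by (simp add: tensor2_def coset_eq_iff)
  then obtain l where lin: "Vector_Spaces.linear free_scale (*) l"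
    and vanish: "\<And>r. r \<in> bilinear_relations sV sW \<Longrightarrow> l r = 0"
    and one: "l (formal_sum xs - formal_sum ys) = 1"
    using linear_separates_from_span by blast
  interpret l: Vector_Spaces.linear free_scale "(*)" l by (rule lin)
  have
    "basis_vec (v + v', w) - basis_vec (v, w) - basis_vec (v', w) \<in> bilinear_relations sV sW"
    "basis_vec (v, w + w') - basis_vec (v, w) - basis_vec (v, w') \<in> bilinear_relations sV sW"
    "basis_vec (sV c v, w) - free_scale c (basis_vec (v, w)) \<in> bilinear_relations sV sW"
    "basis_vec (v, sW c w) - free_scale c (basis_vec (v, w)) \<in> bilinear_relations sV sW"
    for v v' w w' c
    unfolding bilinear_relations_def by blast+
  note vanish = this[THEN vanish, unfolded l.diff l.scale]
  have
    "l (basis_vec (v + v', w)) = l (basis_vec (v, w)) + l (basis_vec (v', w))"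
    "l (basis_vec (v, w + w')) = l (basis_vec (v, w)) + l (basis_vec (v, w'))"
    "l (basis_vec (sV c v, w)) = c * l (basis_vec (v, w))"
    "l (basis_vec (v, sW c w)) = c * l (basis_vec (v, w))" for v v' w w' c
    using vanish(1)[of v v' w] vanish(2)[of v w w'] vanish(3)[of c v w] vanish(4)[of v c w]
    by (simp_all add: algebra_simps)
  then have "bilinear_form sV sW (\<lambda>v w. l (basis_vec (v, w)))"
    by (simp add: bilinear_form_def dual_iff[OF V] dual_iff[OF W])
  from eq[OF this] have "l (formal_sum xs) = l (formal_sum ys)"
    by (simp add: linear_formal_sum[OF lin] split_def)
  with one show False by (simp add: l.diff)
qed

text \<open>Passes from a vanishing statement in which the first tensor factor is only seen by
  functionals \<open>g\<close> to one in which it is substituted into \<open>G\<close>. Expand each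
  \<open>u\<close> in a Hamel basis \<open>A\<close> and use the hypothesis with \<open>g\<close> a
  coordinate functional and \<open>a\<close> the matching basis vector. Only the finitely many basis
  vectors in \<open>F\<close> occur, so the dimension may be infinite.\<close>

lemma bilinear_vanish:
  assumes "vector_space scale"
    and G: "\<And>p. (\<lambda>a. G a p) \<in> dual scale"
    and 0: "\<And>g a. g \<in> dual scale \<Longrightarrow> (\<Sum>(u, p)\<leftarrow>t. g u * G a p) = 0"
  shows "(\<Sum>(u, p)\<leftarrow>t. G u p) = 0"
proof -
  interpret vector_space scale by fact
  obtain A where A: "independent A" "span A = UNIV"
    by (rule maximal_independent_subset[of UNIV]) (simp add: top_unique)
  define F where "F = (\<Union>(u, p)\<in>set t. {b. representation A u b \<noteq> 0})"
  have F: "finite F"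
    unfolding F_def by (auto intro: finite_representation)
  have "G u p = (\<Sum>b\<in>F. representation A u b * G b p)" if "(u, p) \<in> set t" for u p
  proof -
    have "{b. representation A u b \<noteq> 0} \<subseteq> F"
      using that by (auto simp: F_def)
    moreover have "u = (\<Sum>b | representation A u b \<noteq> 0. scale (representation A u b) b)"
      using sum_nonzero_representation_eq[OF A(1)] A(2) by simp
    ultimately have "u = (\<Sum>b\<in>F. scale (representation A u b) b)"
      using F by (subst (asm) sum.mono_neutral_left[where T = F]) auto
    then have "G u p = G (\<Sum>b\<in>F. scale (representation A u b) b) p"
      by simp
    also have "\<dots> = (\<Sum>b\<in>F. representation A u b * G b p)"
      using F by (induction F) (simp_all add: dual_add[OF G] dual_scale[OF G] dual_zero[OF G])
    finally show ?thesis .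
  qed
  then have "(\<Sum>(u, p)\<leftarrow>t. G u p) = (\<Sum>(u, p)\<leftarrow>t. \<Sum>b\<in>F. representation A u b * G b p)"
    by (intro arg_cong[where f = sum_list] map_cong) auto
  also have "\<dots> = (\<Sum>b\<in>F. \<Sum>(u, p)\<leftarrow>t. representation A u b * G b p)"
    by (induction t) (auto simp: sum.distrib)
  also have "\<dots> = 0"
  proof (intro sum.neutral ballI)
    fix b
    have "(\<lambda>u. representation A u b) \<in> dual scale"
      using A by (simp add: dual_iff[OF vector_space_axioms] representation_add representation_scale)
    then show "(\<Sum>(u, p)\<leftarrow>t. representation A u b * G b p) = 0" by (rule 0)
  qed
  finally show ?thesis .
qed

section \<open>Hopf algebra axioms evaluated on forms\<close>

context hopf_algebra
begin

lemmas dual_iff_scale = dual_iff[OF vector_space_axioms]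

text \<open>\<open>comult\<close> is linear only modulo the tensor relations; pairing its value with
  a bilinear form restores honest linearity.\<close>

lemma comult_dual:
  assumes "bilinear_form scale scale \<beta>"
  shows "(\<lambda>x. \<Sum>(x1, x2)\<leftarrow>comult x. \<beta> x1 x2) \<in> dual scale"
proof -
  have "(\<lambda>a. \<beta> a b) \<in> dual scale" for b
    using assms by (simp add: bilinear_form_def)
  from dual_scale[OF this] show ?thesis
    using tensor2_eqD[OF comult_add assms] tensor2_eqD[OF comult_scale assms]
    by (auto simp: dual_iff_scale sum_list_const_mult split_def comp_def)
qed

lemma comult_mult_form:
  assumes "bilinear_form scale scale \<beta>"
  shows "(\<Sum>(z1, z2)\<leftarrow>comult (x * y). \<beta> z1 z2) =
    (\<Sum>(x1, x2)\<leftarrow>comult x. \<Sum>(y1, y2)\<leftarrow>comult y. \<beta> (x1 * y1) (x2 * y2))"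
  using tensor2_eqD[OF comult_mult assms]
  by (simp add: sum_list_map_concat_map comp_def split_def)

lemma comult_one_form:
  assumes "bilinear_form scale scale \<beta>"
  shows "(\<Sum>(z1, z2)\<leftarrow>comult 1. \<beta> z1 z2) = \<beta> 1 1"
  using tensor2_eqD[OF comult_one assms] by simp

lemma coassoc_form:
  assumes "trilinear_form scale scale scale \<tau>"
  shows "(\<Sum>(x1, x2)\<leftarrow>comult x. \<Sum>(x11, x12)\<leftarrow>comult x1. \<tau> x11 x12 x2) =
    (\<Sum>(x1, x2)\<leftarrow>comult x. \<Sum>(x21, x22)\<leftarrow>comult x2. \<tau> x1 x21 x22)"
  using tensor3_eqD[OF coassoc assms]
  by (simp add: sum_list_map_concat_map comp_def split_def)

lemma counit_left_form:
  assumes "g \<in> dual scale"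
  shows "(\<Sum>(x1, x2)\<leftarrow>comult x. counit x1 * g x2) = g x"
  using arg_cong[OF counit_left, of g]
  by (simp add: dual_sum_list[OF assms] dual_scale[OF assms] split_def)

lemma counit_right_form:
  assumes "g \<in> dual scale"
  shows "(\<Sum>(x1, x2)\<leftarrow>comult x. counit x2 * g x1) = g x"
  using arg_cong[OF counit_right, of g]
  by (simp add: dual_sum_list[OF assms] dual_scale[OF assms] split_def)

lemma antipode_left_form:
  assumes "g \<in> dual scale"
  shows "(\<Sum>(x1, x2)\<leftarrow>comult x. g (antipode x1 * x2)) = counit x * g 1"
  using arg_cong[OF antipode_left, of g]
  by (simp add: dual_sum_list[OF assms] dual_scale[OF assms] split_def)

lemma antipode_right_form:
  assumes "g \<in> dual scale"
  shows "(\<Sum>(x1, x2)\<leftarrow>comult x. g (x1 * antipode x2)) = counit x * g 1"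
  using arg_cong[OF antipode_right, of g]
  by (simp add: dual_sum_list[OF assms] dual_scale[OF assms] split_def)

lemma antipode_add: "antipode (x + y) = antipode x + antipode y"
  and antipode_scale: "antipode (c *s x) = c *s antipode x"
  using antipode_linear by (auto simp: Vector_Spaces.linear_iff)

lemmas mult_linear = distrib_left distrib_right scale_mult_left scale_mult_right
  antipode_add antipode_scale

section \<open>Exchange identity and right integrals\<close>

lemma left_integral_form:
  assumes "f \<in> left_integrals scale comult" "g \<in> dual scale"
  shows "(\<Sum>(x1, x2)\<leftarrow>comult x. g x1 * f x2) = g 1 * f x"
  using assms by (auto simp: left_integrals_def convolution_def fun_scale_def fun_eq_iff)

text \<open>The integral property of \<open>f\<close> at x2 y, tested with the functional g(S(x1)
  _), gives g(S(x1)) f(x2 y) = g(S(x1) x2 y1) f(x3 y2), summed over the coproducts. Then S(x1) x2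
  collapses and g(y1) f(x y2) remains.\<close>

lemma left_integral_exchange:
  assumes f: "f \<in> left_integrals scale comult" and g: "g \<in> dual scale"
  shows "(\<Sum>(x1, x2)\<leftarrow>comult x. g (antipode x1) * f (x2 * y)) =
    (\<Sum>(y1, y2)\<leftarrow>comult y. g y1 * f (x * y2))"
proof -
  have df: "f \<in> dual scale" using f by (simp add: left_integrals_def)
  note lin = dual_add[OF df] dual_scale[OF df] dual_add[OF g] dual_scale[OF g] mult_linear
  let ?\<tau> = "\<lambda>a b c. \<Sum>(y1, y2)\<leftarrow>comult y. g (antipode a * (b * y1)) * f (c * y2)"
  have tri: "trilinear_form scale scale scale ?\<tau>"
    by (simp add: trilinear_form_def bilinear_form_def dual_iff_scale split_def lin
        sum_list_addf sum_list_const_mult algebra_simps)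
  have "g (antipode a) * f (b * y) = (\<Sum>(p, q)\<leftarrow>comult b. ?\<tau> a p q)" for a b
  proof -
    have ga: "(\<lambda>z. g (antipode a * z)) \<in> dual scale"
      by (simp add: dual_iff_scale lin)
    have "bilinear_form scale scale (\<lambda>u w. g (antipode a * u) * f w)"
      by (simp add: bilinear_form_def dual_iff_scale lin algebra_simps)
    from comult_mult_form[OF this, of b y] left_integral_form[OF f ga, of "b * y"]
    show ?thesis by (simp add: mult.assoc)
  qed
  then have "(\<Sum>(x1, x2)\<leftarrow>comult x. g (antipode x1) * f (x2 * y)) =
      (\<Sum>(x1, x2)\<leftarrow>comult x. \<Sum>(p, q)\<leftarrow>comult x2. ?\<tau> x1 p q)"
    by simp
  also have "\<dots> = (\<Sum>(x1, x2)\<leftarrow>comult x. \<Sum>(p, q)\<leftarrow>comult x1. ?\<tau> p q x2)"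
    by (rule coassoc_form[OF tri, symmetric])
  \<comment> \<open>After regrouping by coassociativity, the first two tensor factors of
    \<open>x\<close> meet as S(x1) x2, and the antipode axiom applies.\<close>
  also have "\<dots> = (\<Sum>(x1, x2)\<leftarrow>comult x. counit x1 * (\<Sum>(y1, y2)\<leftarrow>comult y. g y1 * f (x2 * y2)))"
  proof -
    have "(\<Sum>(p, q)\<leftarrow>comult a. ?\<tau> p q b) =
        counit a * (\<Sum>(y1, y2)\<leftarrow>comult y. g y1 * f (b * y2))" for a b
    proof -
      have "(\<lambda>z. \<Sum>(y1, y2)\<leftarrow>comult y. g (z * y1) * f (b * y2)) \<in> dual scale"
        by (simp add: dual_iff_scale split_def lin sum_list_addf sum_list_const_mult algebra_simps)
      from antipode_left_form[OF this] show ?thesis by (simp add: mult.assoc)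
    qed
    then show ?thesis by simp
  qed
  also have "\<dots> = (\<Sum>(y1, y2)\<leftarrow>comult y. g y1 * f (x * y2))"
    by (rule counit_left_form)
      (simp add: dual_iff_scale split_def lin sum_list_addf sum_list_const_mult algebra_simps)
  finally show ?thesis .
qed

text \<open>In other words, \<open>f \<circ> antipode\<close> is a right integral. Write c, d for
  the coproduct factors of S(x1). Then f(S(x1)) g(x2) = g(c x2) f(d) = g(c x2) f(d x3 S(x4)), and
  the last term pairs the coproduct of S(x1) x2 with g and f(_ S(x3)). Since S(x1) x2 collapses to
  the counit, f(S(x)) g(1) remains.\<close>

lemma left_integral_antipode:
  assumes f: "f \<in> left_integrals scale comult" and g: "g \<in> dual scale"
  shows "(\<Sum>(x1, x2)\<leftarrow>comult x. f (antipode x1) * g x2) = f (antipode x) * g 1"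
proof -
  have df: "f \<in> dual scale" using f by (simp add: left_integrals_def)
  note lin = dual_add[OF df] dual_scale[OF df] dual_add[OF g] dual_scale[OF g] mult_linear
  \<comment> \<open>Inserting \<open>x\<^sub>3 S(x\<^sub>4)\<close> makes the coproduct of \<open>S(x\<^sub>1) x\<^sub>2\<close> appear, so that
    anti-comultiplicativity of \<open>S\<close> is not needed.\<close>
  define \<Phi> where "\<Phi> = (\<lambda>s a. \<Sum>(c, d)\<leftarrow>comult a. g c * f (d * antipode s))"
  have bil: "bilinear_form scale scale (\<lambda>c d. g c * f (d * antipode s))" for s
    by (simp add: bilinear_form_def dual_iff_scale lin algebra_simps)
  have \<Phi>_dual: "\<Phi> s \<in> dual scale" for s
    unfolding \<Phi>_def by (rule comult_dual[OF bil])
  have \<Phi>_dual': "(\<lambda>s. \<Phi> s a) \<in> dual scale" for a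
    unfolding \<Phi>_def
    by (simp add: dual_iff_scale split_def lin sum_list_addf sum_list_const_mult algebra_simps)
  have tri: "trilinear_form scale scale scale (\<lambda>a b s. \<Phi> s (antipode a * b))"
    using dual_add[OF \<Phi>_dual] dual_scale[OF \<Phi>_dual] dual_add[OF \<Phi>_dual'] dual_scale[OF \<Phi>_dual']
    by (simp add: trilinear_form_def bilinear_form_def dual_iff_scale mult_linear)
  \<comment> \<open>Coassociativity brings the second and third factors of \<open>b\<close> together
    as b2 S(b3), which collapses; read from right to left, this is the insertion.\<close>
  have cancel: "(\<Sum>(q, s)\<leftarrow>comult b. \<Sum>(q1, q2)\<leftarrow>comult q. g (c * q1) * f (d * q2 * antipode s)) =
      g (c * b) * f d" for b c d
  proof -
    have "trilinear_form scale scale scale (\<lambda>q1 q2 s. g (c * q1) * f (d * q2 * antipode s))"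
      by (simp add: trilinear_form_def bilinear_form_def dual_iff_scale lin algebra_simps)
    from coassoc_form[OF this]
    have "(\<Sum>(q, s)\<leftarrow>comult b. \<Sum>(q1, q2)\<leftarrow>comult q. g (c * q1) * f (d * q2 * antipode s)) =
        (\<Sum>(q, s)\<leftarrow>comult b. \<Sum>(s1, s2)\<leftarrow>comult s. g (c * q) * f (d * s1 * antipode s2))" .
    also have "\<dots> = (\<Sum>(q, s)\<leftarrow>comult b. counit s * (g (c * q) * f d))"
    proof -
      have "(\<Sum>(s1, s2)\<leftarrow>comult s. g (c * q) * f (d * s1 * antipode s2)) =
          counit s * (g (c * q) * f d)" for q s
      proof -
        have "(\<lambda>z. g (c * q) * f (d * z)) \<in> dual scale"
          by (simp add: dual_iff_scale lin algebra_simps)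
        from antipode_right_form[OF this] show ?thesis by (simp add: mult.assoc)
      qed
      then show ?thesis by simp
    qed
    also have "\<dots> = g (c * b) * f d"
      by (rule counit_right_form) (simp add: dual_iff_scale lin algebra_simps)
    finally show ?thesis .
  qed
  have "f (antipode a) * g b = (\<Sum>(q, s)\<leftarrow>comult b. \<Phi> s (antipode a * q))" for a b
  proof -
    have gb: "(\<lambda>z. g (z * b)) \<in> dual scale"
      by (simp add: dual_iff_scale lin)
    have "f (antipode a) * g b = (\<Sum>(c, d)\<leftarrow>comult (antipode a). g (c * b) * f d)"
      using left_integral_form[OF f gb] by (simp add: mult.commute)
    also have "\<dots> = (\<Sum>(c, d)\<leftarrow>comult (antipode a). \<Sum>(q, s)\<leftarrow>comult b.
        \<Sum>(q1, q2)\<leftarrow>comult q. g (c * q1) * f (d * q2 * antipode s))"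
      by (simp add: cancel)
    \<comment> \<open>With the sum over \<open>comult b\<close> outermost, the coproducts of S(a)
      and \<open>q\<close> are adjacent and merge into that of S(a) q.\<close>
    also have "\<dots> = (\<Sum>(q, s)\<leftarrow>comult b. \<Sum>(c, d)\<leftarrow>comult (antipode a).
        \<Sum>(q1, q2)\<leftarrow>comult q. g (c * q1) * f (d * q2 * antipode s))"
      unfolding split_def by (rule sum_list_map_swap)
    also have "\<dots> = (\<Sum>(q, s)\<leftarrow>comult b. \<Phi> s (antipode a * q))"
      unfolding \<Phi>_def by (simp add: comult_mult_form[OF bil])
    finally show ?thesis .
  qed
  then have "(\<Sum>(x1, x2)\<leftarrow>comult x. f (antipode x1) * g x2) =
      (\<Sum>(x1, x2)\<leftarrow>comult x. \<Sum>(q, s)\<leftarrow>comult x2. \<Phi> s (antipode x1 * q))"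
    by simp
  also have "\<dots> = (\<Sum>(x1, x2)\<leftarrow>comult x. \<Sum>(p, q)\<leftarrow>comult x1. \<Phi> x2 (antipode p * q))"
    by (rule coassoc_form[OF tri, symmetric])
  also have "\<dots> = (\<Sum>(x1, x2)\<leftarrow>comult x. counit x1 * \<Phi> x2 1)"
    by (simp add: antipode_left_form[OF \<Phi>_dual])
  also have "\<dots> = \<Phi> x 1"
    by (rule counit_left_form[OF \<Phi>_dual'])
  also have "\<dots> = f (antipode x) * g 1"
    unfolding \<Phi>_def by (simp add: comult_one_form[OF bil] mult.commute)
  finally show ?thesis .
qed

section \<open>Uniqueness of left integrals up to scalars\<close>

lemma left_integral_eq_0:
  assumes f: "f \<in> left_integrals scale comult" and \<phi>: "\<phi> \<in> left_integrals scale comult"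
    and fy: "f y \<noteq> 0" and \<phi>y: "\<phi> y = 0"
  shows "\<phi> x = 0"
proof -
  have df: "f \<in> dual scale" and d\<phi>: "\<phi> \<in> dual scale"
    using f \<phi> by (simp_all add: left_integrals_def)
  have d\<epsilon>: "counit \<in> dual scale" using counit_linear by (simp add: dual_def)
  note lin = dual_add[OF d\<phi>] dual_scale[OF d\<phi>] mult_linear
  \<comment> \<open>Contracting the first factor of the coproduct of \<open>y\<close> with
    \<open>f\<close> serves two ends: \<phi> vanishes on all left multiples of \<open>v\<close>,
    while its counit is the nonzero scalar f(y).\<close>
  define v where "v = (\<Sum>(y1, y2)\<leftarrow>comult y. f y1 *s y2)"
  have \<phi>v: "\<phi> (z * v) = 0" for z
  proof -
    have "(\<lambda>w. \<phi> (z * w)) \<in> dual scale"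
      by (simp add: dual_iff_scale lin)
    then have "\<phi> (z * v) = (\<Sum>(y1, y2)\<leftarrow>comult y. f y1 * \<phi> (z * y2))"
      unfolding v_def by (simp add: dual_sum_list[of "\<lambda>w. \<phi> (z * w)"] split_def lin)
    \<comment> \<open>Here \<phi> is the integral and \<open>f\<close> merely the test functional;
      in the next step \<open>f\<close> is the integral and \<phi>(_ y) the test functional.\<close>
    also have "\<dots> = (\<Sum>(z1, z2)\<leftarrow>comult z. f (antipode z1) * \<phi> (z2 * y))"
      by (rule left_integral_exchange[OF \<phi> df, symmetric])
    also have "\<dots> = f (antipode z) * \<phi> (1 * y)"
      by (rule left_integral_antipode[OF f]) (simp add: dual_iff_scale lin)
    finally show ?thesis using \<phi>y by simp
  qed
  have "counit v = (\<Sum>(y1, y2)\<leftarrow>comult y. counit y2 * f y1)"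
    unfolding v_def
    by (simp add: dual_sum_list[OF d\<epsilon>] dual_scale[OF d\<epsilon>] split_def mult.commute)
  then have \<epsilon>v: "counit v = f y"
    using counit_right_form[OF df] by simp
  \<comment> \<open>This sum is computed in two ways. Decoupling S(v1) as S(a) allows the exchange
    identity with z = x S(a), which turns each contraction into a sum of terms containing \<phi>(z2
    v) = 0. The antipode axiom, on the other hand, gives the counit of \<open>v\<close> times
    \<phi>(x).\<close>
  have "(\<Sum>(v1, v2)\<leftarrow>comult v. \<phi> (x * antipode v1 * v2)) = 0"
  proof (rule bilinear_vanish[OF vector_space_axioms])
    show "(\<lambda>a. \<phi> (x * antipode a * p)) \<in> dual scale" for p
      by (simp add: dual_iff_scale lin)
    show "(\<Sum>(v1, v2)\<leftarrow>comult v. g v1 * \<phi> (x * antipode a * v2)) = 0" if "g \<in> dual scale" for g a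
      unfolding left_integral_exchange[OF \<phi> that, symmetric] by (simp add: \<phi>v split_def)
  qed
  moreover have "(\<lambda>z. \<phi> (x * z)) \<in> dual scale"
    by (simp add: dual_iff_scale lin)
  ultimately have "counit v * \<phi> x = 0"
    using antipode_left_form[of "\<lambda>z. \<phi> (x * z)" v] by (simp add: mult.assoc)
  with \<epsilon>v fy show ?thesis by simp
qed

lemma left_integrals_subspace: "fun_space.subspace (left_integrals scale comult)"
  unfolding fun_space.subspace_def left_integrals_def convolution_def fun_scale_def
  by (auto simp: dual_iff_scale fun_eq_iff algebra_simps split_def sum_list_addf
      sum_list_const_mult zero_fun_def plus_fun_def)

text \<open>A spanning singleton is stronger than a bound on \<open>fun_space.dim\<close>, whose
  value is also 0 on a space with an infinite basis.\<close>

theorem left_integrals_span_singleton: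
  obtains f where "left_integrals scale comult = fun_space.span {f}"
proof (cases "left_integrals scale comult \<subseteq> {0}")
  case True
  \<comment> \<open>The generator may be 0, so the zero space is covered as well.\<close>
  then have "left_integrals scale comult = fun_space.span {0}"
    using fun_space.subspace_0[OF left_integrals_subspace] by auto
  then show ?thesis by (rule that)
next
  case False
  then obtain f where f: "f \<in> left_integrals scale comult" and "f \<noteq> 0"
    by auto
  then obtain y where fy: "f y \<noteq> 0"
    by (auto simp: fun_eq_iff)
  have "h \<in> fun_space.span {f}" if h: "h \<in> left_integrals scale comult" for h
  proof -
    let ?\<phi> = "h - fun_scale (h y / f y) f"
    have "?\<phi> \<in> left_integrals scale comult"
      by (intro fun_space.subspace_diff[OF left_integrals_subspace h]
          fun_space.subspace_scale[OF left_integrals_subspace f])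
    moreover have "?\<phi> y = 0" using fy by (simp add: fun_scale_def)
    ultimately have "?\<phi> x = 0" for x
      by (rule left_integral_eq_0[OF f _ fy])
    then have "?\<phi> = 0" by (intro ext) (simp only: zero_fun_def)
    then have "h = fun_scale (h y / f y) f" by (simp only: right_minus_eq)
    then show ?thesis by (auto simp: fun_space.span_singleton)
  qed
  moreover have "fun_space.span {f} \<subseteq> left_integrals scale comult"
    using f by (intro fun_space.span_minimal left_integrals_subspace) simp
  ultimately show ?thesis using that by blast
qed

end

section \<open>Reduction of the braided case to an ordinary Hopf algebra\<close>

text \<open>If the coaction is trivial, the braiding is the flip.\<close>

lemma (in braided_hopf_algebra) hopf_algebra_if_trivial_coact:
  assumes "\<And>h. tensor2 scaleB scaleH (coact h) = tensor2 scaleB scaleH [(1, h)]"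
  shows "hopf_algebra scaleH comult counit antipode"
proof (intro hopf_algebra.intro hopf_algebra_axioms.intro)
  fix x y
  note V = M.vector_space_axioms
  have "(\<Sum>(a, b)\<leftarrow>[(x1 * v, u * y2). (x1, x2) \<leftarrow> comult x, (y1, y2) \<leftarrow> comult y, (v, u) \<leftarrow> braiding x2 y1]. \<beta> a b)
      = (\<Sum>(a, b)\<leftarrow>[(x1 * y1, x2 * y2). (x1, x2) \<leftarrow> comult x, (y1, y2) \<leftarrow> comult y]. \<beta> a b)"
    if \<beta>: "bilinear_form scaleH scaleH \<beta>" for \<beta>
  proof -
    have d: "(\<lambda>a. \<beta> a b) \<in> dual scaleH" "\<beta> a \<in> dual scaleH" for a b
      using \<beta> by (simp_all add: bilinear_form_def)
    \<comment> \<open>For fixed x1, y1, y2 the left side is a bilinear form evaluated on the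
      coaction of x2. That coaction may be replaced by the single pair (1, x2), and 1 acts as the
      identity.\<close>
    have "(\<Sum>(v, u)\<leftarrow>braiding x2 y1. \<beta> (x1 * v) (u * y2)) = \<beta> (x1 * y1) (x2 * y2)" for x1 x2 y1 y2
    proof -
      have "bilinear_form scaleB scaleH (\<lambda>b u. \<beta> (x1 * act b y1) (u * y2))"
        using act_linear_left[of y1] dual_add[OF d(1)] dual_add[OF d(2)] dual_scale[OF d(1)] dual_scale[OF d(2)]
        by (simp add: bilinear_form_def dual_iff[OF V] dual_iff[OF B.vector_space_axioms]
            Vector_Spaces.linear_iff distrib_left distrib_right H.scale_mult_left H.scale_mult_right)
      from tensor2_eqD[OF assms this, of x2] show ?thesis
        by (simp add: braiding_def act_one split_def comp_def)
    qed
    then show ?thesis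
      by (simp add: sum_list_map_concat_map comp_def split_def)
  qed
  then show "tensor2 scaleH scaleH (comult (x * y)) =
      tensor2 scaleH scaleH [(x1 * y1, x2 * y2). (x1, x2) \<leftarrow> comult x, (y1, y2) \<leftarrow> comult y]"
    unfolding comult_mult by (rule tensor2_eqI[OF V V])
qed (rule H.unital_algebra_axioms H.coalgebra_axioms comult_one counit_mult counit_one
    antipode_linear antipode_left antipode_right)+

theorem mainTheorem10:
  fixes scaleB :: "'k::field \<Rightarrow> 'b::ring_1 \<Rightarrow> 'b"
    and comultB :: "'b \<Rightarrow> ('b \<times> 'b) list"
    and counitB :: "'b \<Rightarrow> 'k"
    and antipodeB :: "'b \<Rightarrow> 'b"
    and scaleH :: "'k \<Rightarrow> 'h::ring_1 \<Rightarrow> 'h"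
    and act :: "'b \<Rightarrow> 'h \<Rightarrow> 'h"
    and coact :: "'h \<Rightarrow> ('b \<times> 'h) list"
    and comult :: "'h \<Rightarrow> ('h \<times> 'h) list"
    and counit :: "'h \<Rightarrow> 'k"
    and antipode :: "'h \<Rightarrow> 'h"
  assumes "hopf_algebra scaleB comultB counitB antipodeB"
    and "\<exists>Bs. finite_dimensional_vector_space scaleB Bs"
    and "braided_hopf_algebra scaleB comultB counitB antipodeB
           scaleH act coact comult counit antipode"
    and "\<And>h. tensor2 scaleB scaleH (coact h) = tensor2 scaleB scaleH [(1, h)]"
  shows "(\<exists>S. finite S \<and> left_integrals scaleH comult = fun_space.span S) \<and>
    (fun_space.dim (left_integrals scaleH comult) = 0 \<or>
     fun_space.dim (left_integrals scaleH comult) = 1)"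
proof -
  interpret hopf_algebra scaleH comult counit antipode
    by (rule braided_hopf_algebra.hopf_algebra_if_trivial_coact[OF assms(3,4)])
  obtain f where f: "left_integrals scaleH comult = fun_space.span {f}"
    by (rule left_integrals_span_singleton)
  have "fun_space.dim (left_integrals scaleH comult) \<le> 1"
    using fun_space.dim_le_card[of "left_integrals scaleH comult" "{f}"] f by simp
  then have "fun_space.dim (left_integrals scaleH comult) = 0 \<or>
      fun_space.dim (left_integrals scaleH comult) = 1" by linarith
  moreover have "finite {f}" by simp
  ultimately show ?thesis using f by blast
qed

end
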